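(* Let $\Omega$ be a locally compact Hausdorff space with Borel $\sigma$-algebra $\mathcal{B}$. Let $m$ and $m_n$, $n\in\mathbb{N}$, be measures in $\mathcal{M}(\Omega)$, with $m$ Radon, and let $f, f_n:\Omega\to\mathbb{R}$ ($n\in\mathbb{N}$) be $\mathcal{B}$-measurable functions. Suppose that (i) $f_n(t)\to f(t)$ for $m$-a.e. $t$; (ii) $f$ is continuous on $\Omega$; (iii) the sequence $(f_n)_n$ and the function $f$ have uniformly absolutely continuous $(m_n)$-integrals on $\Omega$; (iv) $(m_n)_n$ is vaguely convergent to $m$ and uniformly absolutely continuous with respect to $m$. Then $f\in L^1(m)$ and $$\lim_n \int_A f_n\,dm_n=\int_A f\,dm\qquad\text{for every } A\in\mathcal{B}.$$
   Context: $\mathcal{M}(\Omega)$ denotes the family of finite nonnegative (countably additive) measures on $(\Omega,\mathcal{B})$. A measure $m\in\mathcal{M}(\Omega)$ is Radon if it is inner regular with respect to compact sets, i.e. $m(A)=\sup\{m(K): K\subset A,\ K \text{ compact}\}$ for every $A\in\mathcal{B}$. Vague convergence of $(m_n)_n$ to $m$: $\int_\Omega g\,dm_n\to\int_\Omega g\,dm$ for every $g\in C_0(\Omega)$, the continuous real functions on $\Omega$ vanishing at infinity. $(m_n)_n$ is uniformly absolutely continuous with respect to $m$ if for each $\varepsilon>0$ there is $\delta>0$ such that for every $E\in\mathcal{B}$: $m(E)<\delta$ implies $\sup_n m_n(E)<\varepsilon$. A sequence $(f_n)_n$ of $\mathcal{B}$-measurable real functions has uniformly absolutely continuous $(m_n)$-integrals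 on $\Omega$ if for every $\varepsilon>0$ there is $\delta>0$ such that for every $n\in\mathbb{N}$ and every $A\in\mathcal{B}$: $m_n(A)<\delta$ implies $\int_A|f_n|\,dm_n<\varepsilon$. A single function $f$ has uniformly absolutely continuous $(m_n)$-integrals if this holds with $f_n:=f$ for every $n$. *)

theory Defs
  imports "HOL-Analysis.Analysis"
begin

definition finite_measures_borel :: "'a::topological_space measure set" where
  "finite_measures_borel = {M. finite_measure M \<and> sets M = sets borel}"

definition radon :: "'a::topological_space measure \<Rightarrow> bool" where
  "radon M \<longleftrightarrow>
     (\<forall>A\<in>sets M. emeasure M A = (SUP K\<in>{K. K \<subseteq> A \<and> compact K}. emeasure M K))"

definition C0 :: "('a::topological_space \<Rightarrow> real) set" where
  "C0 = {g. continuous_on UNIV g \<and> (\<forall>\<epsilon>>0. \<exists>K. compact K \<and> (\<forall>x. x \<notin> K \<longrightarrow> \<bar>g x\<bar> < \<epsilon>))}"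

definition vaguely_convergent ::
    "(nat \<Rightarrow> 'a::topological_space measure) \<Rightarrow> 'a measure \<Rightarrow> bool" where
  "vaguely_convergent M m \<longleftrightarrow>
     (\<forall>g\<in>C0. (\<lambda>n. integral\<^sup>L (M n) g) \<longlonglongrightarrow> integral\<^sup>L m g)"

text \<open>The supremum is taken in the extended nonnegative reals, so that it is meaningful
  without any boundedness assumption.\<close>

definition uniformly_absolutely_continuous ::
    "(nat \<Rightarrow> 'a::topological_space measure) \<Rightarrow> 'a measure \<Rightarrow> bool" where
  "uniformly_absolutely_continuous M m \<longleftrightarrow>
     (\<forall>\<epsilon>::real>0. \<exists>\<delta>::real>0. \<forall>E\<in>sets borel.
        emeasure m E < ennreal \<delta> \<longrightarrow> (SUP n. emeasure (M n) E) < ennreal \<epsilon>)"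

text \<open>The integral of the absolute value is the nonnegative (extended-valued) integral: the
  Bochner integral would be 0 by convention for a non-integrable function.\<close>

definition uac_integrals ::
    "(nat \<Rightarrow> 'a::topological_space measure) \<Rightarrow> (nat \<Rightarrow> 'a \<Rightarrow> real) \<Rightarrow> bool" where
  "uac_integrals M F \<longleftrightarrow>
     (\<forall>\<epsilon>::real>0. \<exists>\<delta>::real>0. \<forall>n. \<forall>A\<in>sets borel.
        emeasure (M n) A < ennreal \<delta> \<longrightarrow> (\<integral>\<^sup>+t\<in>A. ennreal \<bar>F n t\<bar> \<partial>M n) < ennreal \<epsilon>)"

text \<open>Uniform absolute continuity of the integrals entails integrability, so Bochner integrals
  of such functions over Borel sets never take the default value 0.\<close>

lemma uac_integrals_integrable:
  assumes M: "M n \<in> finite_measures_borel"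
    and F: "F n \<in> borel_measurable borel"
    and uac: "uac_integrals M F"
  shows "integrable (M n) (F n)"
proof -
  interpret finite_measure "M n"
    using M by (simp add: finite_measures_borel_def)
  have sets_M [measurable_cong]: "sets (M n) = sets borel"
    using M by (simp add: finite_measures_borel_def)
  have meas [measurable]: "F n \<in> borel_measurable (M n)"
    using F sets_M measurable_cong_sets by blast
  obtain \<delta> :: real where \<delta>: "\<delta> > 0"
    and small: "\<And>A. A \<in> sets borel \<Longrightarrow> emeasure (M n) A < ennreal \<delta> \<Longrightarrow>
          (\<integral>\<^sup>+t\<in>A. ennreal \<bar>F n t\<bar> \<partial>M n) < ennreal 1"
    using uac unfolding uac_integrals_def by (meson zero_less_one)
  define A where "A k = {t \<in> space (M n). real k < \<bar>F n t\<bar>}" for k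
  have A_sets [measurable]: "A k \<in> sets (M n)" for k
    unfolding A_def by measurable
  have "(\<Inter>k. A k) = {}"
  proof -
    have False if "\<forall>k. t \<in> A k" for t
    proof -
      obtain k where "\<bar>F n t\<bar> < real k"
        using reals_Archimedean2 by blast
      moreover have "real k < \<bar>F n t\<bar>"
        using that by (simp add: A_def)
      ultimately show False
        by simp
    qed
    then show ?thesis
      by auto
  qed
  moreover have "decseq A"
    by (force simp: decseq_def A_def)
  ultimately have "(\<lambda>k. emeasure (M n) (A k)) \<longlonglongrightarrow> 0"
    using Lim_emeasure_decseq[of A "M n"] A_sets by (auto simp: image_subset_iff)
  then have "eventually (\<lambda>k. emeasure (M n) (A k) < ennreal \<delta>) sequentially"
    using \<delta> by (intro order_tendstoD) auto
  then obtain k where k: "emeasure (M n) (A k) < ennreal \<delta>"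
    by (auto simp: eventually_sequentially)
  have "(\<integral>\<^sup>+t. ennreal \<bar>F n t\<bar> \<partial>M n)
      \<le> (\<integral>\<^sup>+t. ennreal \<bar>F n t\<bar> * indicator (A k) t + ennreal (real k) \<partial>M n)"
    by (intro nn_integral_mono) (auto simp: A_def indicator_def intro: ennreal_leI)
  also have "\<dots> = (\<integral>\<^sup>+t\<in>A k. ennreal \<bar>F n t\<bar> \<partial>M n) + ennreal (real k) * emeasure (M n) (space (M n))"
    by (subst nn_integral_add) auto
  also have "\<dots> < \<infinity>"
    using small[of "A k"] k A_sets[of k] sets_M emeasure_finite[of "space (M n)"]
    by (auto simp: ennreal_mult_eq_top_iff less_top[symmetric] top_unique)
  finally show ?thesis
    using meas by (intro integrableI_bounded) auto
qed

end

theory Submission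
  imports Defs
begin

text \<open>
  The topology enters only through the first of two steps: vague convergence, together with
  uniform absolute continuity, improves to convergence \<open>M n A \<longlonglongrightarrow> m A\<close> on every Borel set \<open>A\<close>.
  The Radon property encloses \<open>A\<close> between a compact \<open>K\<close> and an open \<open>U\<close> with \<open>m (U - K)\<close>
  small (\<open>radon_sandwich\<close>), and Urysohn's lemma supplies a test function in \<open>C0\<close> that is 1 on
  \<open>K\<close> and 0 off \<open>U\<close> (\<open>Urysohn_C0\<close>). Replacing the indicator of \<open>A\<close> by it costs at most the
  mass of \<open>U - K\<close>, which is small for \<open>m\<close> and, by uniform absolute continuity, for all \<open>M n\<close>
  simultaneously (\<open>vague_imp_setwise\<close>).

  The second step is a Vitali convergence theorem for a setwise convergent sequence of finite
  measures, on any measurable space. Composing the modulus of uniform absolute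
  continuity of the measures with that of the integrals shows that the integrals of
  \<open>\<bar>F n\<bar>\<close> and \<open>\<bar>f\<bar>\<close> with respect to \<open>M n\<close> are uniformly small on sets of small \<open>m\<close>-measure.
  This lets the problem be split as
  \<open>\<integral>\<^sub>A F n dM n - \<integral>\<^sub>A f dm = \<integral>\<^sub>A (F n - f) dM n + (\<integral>\<^sub>A f dM n - \<integral>\<^sub>A f dm)\<close>.
  The first difference vanishes in the limit because the set where \<open>\<bar>F n - f\<bar> > \<eta>\<close> has \<open>m\<close>-measure
  tending to 0, hence contributes little, while the rest contributes at most \<open>\<eta>\<close> times the
  bounded mass of \<open>M n\<close> (\<open>tendsto_integral_abs_diff\<close>). The second vanishes because \<open>f\<close> may be
  truncated at a high level with an error uniform in \<open>n\<close>, and integrals of bounded functions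
  converge under setwise convergence (\<open>tendsto_set_integral\<close>). The truncation error
  with respect to \<open>m\<close> is inherited from the \<open>M n\<close> by a Fatou argument (\<open>integral_limit_le\<close>),
  which is also the source of the integrability of \<open>f\<close>.
\<close>

section \<open>Setwise convergent sequences of finite measures\<close>

text \<open>The Moore-Osgood exchange of limits, in the form in which it turns each approximation below
  (of a set by test functions, of a bounded function by simple ones, of \<open>f\<close> by truncations) into
  convergence; the error must be uniform in \<open>n\<close>.\<close>

lemma tendsto_by_approximation:
  fixes a :: "nat \<Rightarrow> real"
  assumes "\<And>\<epsilon>. \<epsilon> > 0 \<Longrightarrow> \<exists>b b'. b \<longlonglongrightarrow> b' \<and> (\<forall>n. \<bar>a n - b n\<bar> \<le> \<epsilon>) \<and> \<bar>a' - b'\<bar> \<le> \<epsilon>"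
  shows "a \<longlonglongrightarrow> a'"
proof (rule LIMSEQ_I)
  fix r :: real assume "r > 0"
  then obtain b b' where b: "b \<longlonglongrightarrow> b'" and ab: "\<And>n. \<bar>a n - b n\<bar> \<le> r / 4" "\<bar>a' - b'\<bar> \<le> r / 4"
    using assms[of "r / 4"] by auto
  obtain N where N: "\<And>n. n \<ge> N \<Longrightarrow> norm (b n - b') < r / 4"
    using LIMSEQ_D[OF b, of "r / 4"] \<open>r > 0\<close> by auto
  have "norm (a n - a') < r" if "n \<ge> N" for n
    using N[OF that] ab(1)[of n] ab(2) unfolding real_norm_def by linarith
  then show "\<exists>N. \<forall>n\<ge>N. norm (a n - a') < r"
    by blast
qed

lemma integrable_indicator_mult:
  fixes h :: "'a \<Rightarrow> real"
  assumes "A \<in> sets N" "integrable N h"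
  shows "integrable N (\<lambda>x. indicator A x * h x)" "integrable N (\<lambda>x. indicator A x * \<bar>h x\<bar>)"
  using integrable_mult_indicator[OF assms]
    integrable_mult_indicator[OF assms(1) integrable_abs[OF assms(2)]] by simp_all

text \<open>Convergence in measure: the indicators of the deviation sets tend to 0 almost everywhere and
  are dominated by the constant 1, which is integrable for a finite measure.\<close>

lemma (in finite_measure) tendsto_measure_deviation:
  fixes F :: "nat \<Rightarrow> 'a \<Rightarrow> real" and f :: "'a \<Rightarrow> real"
  assumes [measurable]: "\<And>n. F n \<in> borel_measurable M" "f \<in> borel_measurable M"
    and lim: "AE x in M. (\<lambda>n. F n x) \<longlonglongrightarrow> f x" and "\<eta> > 0"
  shows "(\<lambda>n. measure M {x \<in> space M. \<eta> < \<bar>F n x - f x\<bar>}) \<longlonglongrightarrow> 0"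
proof -
  let ?E = "\<lambda>n. {x \<in> space M. \<eta> < \<bar>F n x - f x\<bar>}"
  have "(\<lambda>n. \<integral>x. indicator (?E n) x \<partial>M) \<longlonglongrightarrow> (\<integral>x. (0::real) \<partial>M)"
  proof (rule integral_dominated_convergence[where w = "\<lambda>_. 1"])
    show "AE x in M. (\<lambda>n. indicator (?E n) x :: real) \<longlonglongrightarrow> 0"
      using lim
    proof eventually_elim
      case (elim x)
      have "\<forall>\<^sub>F n in sequentially. dist (F n x) (f x) < \<eta>"
        using elim \<open>\<eta> > 0\<close> by (rule tendstoD)
      then have "\<forall>\<^sub>F n in sequentially. indicator (?E n) x = (0::real)"
        by eventually_elim (auto simp: dist_real_def)
      then show ?case
        by (rule tendsto_eventually)
    qed
  qed (auto split: split_indicator)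
  then show ?thesis
    by (simp add: Int_def conj_ac)
qed

locale setwise_limit = finite_measure m
  for m :: "'a measure" +
  fixes M :: "nat \<Rightarrow> 'a measure"
  assumes finite_M: "finite_measure (M n)"
    and sets_M [measurable_cong]: "sets (M n) = sets m"
    and setwise: "A \<in> sets m \<Longrightarrow> (\<lambda>n. measure (M n) A) \<longlonglongrightarrow> measure m A"
begin

lemma space_M: "space (M n) = space m"
  using sets_M by (rule sets_eq_imp_space_eq)

lemma mass_bounded:
  obtains C where "C > 0" "\<And>n. measure (M n) (space m) \<le> C" "measure m (space m) \<le> C"
proof -
  obtain C where "C > 0" and C: "\<And>n. norm (measure (M n) (space m)) \<le> C"
    using BseqE[OF convergent_imp_Bseq[OF convergentI[OF setwise[OF sets.top]]]] by blast
  have "measure m (space m) \<le> C"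
    by (rule LIMSEQ_le_const2[OF setwise[OF sets.top]]) (use C in auto)
  with C \<open>C > 0\<close> show thesis
    by (intro that[of C]) auto
qed

lemma integrable_bounded:
  fixes h :: "'a \<Rightarrow> real"
  assumes "h \<in> borel_measurable m" "\<And>x. \<bar>h x\<bar> \<le> B"
  shows "integrable (M n) h" "integrable m h"
proof -
  interpret Mn: finite_measure "M n"
    by (rule finite_M)
  have "h \<in> borel_measurable (M n)"
    using assms(1) by measurable
  then show "integrable (M n) h"
    using assms(2) by (intro Mn.integrable_const_bound[where B = B]) auto
  show "integrable m h"
    using assms by (intro integrable_const_bound[where B = B]) auto
qed

text \<open>Setwise convergence is convergence of the integrals of simple functions. Rounding \<open>h\<close> down to
  a multiple of \<open>d\<close> gives a simple function within \<open>d\<close> of \<open>h\<close> everywhere, so the error in the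
  integral is at most \<open>d\<close> times the mass, and all the masses are bounded by a common \<open>C\<close>.\<close>

lemma tendsto_integral_bounded:
  fixes h :: "'a \<Rightarrow> real"
  assumes h [measurable]: "h \<in> borel_measurable m" and bound: "\<And>x. \<bar>h x\<bar> \<le> B"
  shows "(\<lambda>n. integral\<^sup>L (M n) h) \<longlonglongrightarrow> integral\<^sup>L m h"
proof (rule tendsto_by_approximation)
  fix \<epsilon> :: real assume "\<epsilon> > 0"
  obtain C where "C > 0" and C: "\<And>n. measure (M n) (space m) \<le> C" "measure m (space m) \<le> C"
    by (rule mass_bounded) blast
  define d where "d = \<epsilon> / C"
  have "d > 0"
    using \<open>C > 0\<close> \<open>\<epsilon> > 0\<close> by (simp add: d_def)
  define J where "J = {\<lfloor>- B / d\<rfloor>..\<lfloor>B / d\<rfloor>}"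
  define L where "L j = {x \<in> space m. \<lfloor>h x / d\<rfloor> = j}" for j
  have L [measurable]: "L j \<in> sets m" for j
    unfolding L_def by measurable
  define g where "g x = (\<Sum>j\<in>J. (d * real_of_int j) * indicator (L j) x)" for x
  have g_eq: "g x = d * real_of_int \<lfloor>h x / d\<rfloor>" if "x \<in> space m" for x
  proof -
    have "- B / d \<le> h x / d" "h x / d \<le> B / d"
      using bound[of x] \<open>d > 0\<close> by (intro divide_right_mono; linarith)+
    then have "\<lfloor>h x / d\<rfloor> \<in> J"
      unfolding J_def by (intro atLeastAtMost_iff[THEN iffD2] conjI floor_mono)
    moreover have "g x = (\<Sum>j\<in>J. if j = \<lfloor>h x / d\<rfloor> then d * real_of_int j else 0)"
      unfolding g_def using that by (intro sum.cong) (auto simp: L_def)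
    ultimately show ?thesis
      by (simp add: J_def)
  qed
  have close: "\<bar>h x - g x\<bar> \<le> d" if "x \<in> space m" for x
  proof -
    have "d * real_of_int \<lfloor>h x / d\<rfloor> \<le> d * (h x / d)" "d * (h x / d) \<le> d * (real_of_int \<lfloor>h x / d\<rfloor> + 1)"
      using \<open>d > 0\<close> by (intro mult_left_mono; linarith)+
    then show ?thesis
      using \<open>d > 0\<close> g_eq[OF that] by (simp add: algebra_simps)
  qed
  \<comment> \<open>Stated for a generic \<open>N\<close>, to serve for every \<open>M n\<close> and for \<open>m\<close>.\<close>
  have approx: "\<bar>integral\<^sup>L N h - integral\<^sup>L N g\<bar> \<le> \<epsilon>"
    and g_int: "integral\<^sup>L N g = (\<Sum>j\<in>J. d * real_of_int j * measure N (L j))"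
    if N: "finite_measure N" "sets N = sets m" "measure N (space m) \<le> C" for N
  proof -
    interpret N: finite_measure N
      by (rule N)
    note [measurable_cong] = N(2)
    have sp: "space N = space m"
      using N(2) by (rule sets_eq_imp_space_eq)
    have int_L: "integrable N (\<lambda>x. (d * real_of_int j) * indicator (L j) x)" for j
      using N(2) L by (intro integrable_mult_right) (auto simp: less_top[symmetric])
    then have int_g: "integrable N g"
      unfolding g_def by (intro Bochner_Integration.integrable_sum) auto
    have int_h: "integrable N h"
      using bound by (intro N.integrable_const_bound[where B = B]) auto
    show "integral\<^sup>L N g = (\<Sum>j\<in>J. d * real_of_int j * measure N (L j))"
      unfolding g_def using int_L N(2) L
      by (subst Bochner_Integration.integral_sum) (auto simp: sets.sets_into_space[OF L] sp Int_absorb1)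
    have "\<bar>integral\<^sup>L N h - integral\<^sup>L N g\<bar> = \<bar>\<integral>x. h x - g x \<partial>N\<bar>"
      using int_g int_h by simp
    also have "\<dots> \<le> (\<integral>x. \<bar>h x - g x\<bar> \<partial>N)"
      by (rule integral_abs_bound)
    also have "\<dots> \<le> (\<integral>x. d \<partial>N)"
      using close int_g int_h by (intro integral_mono) (auto simp: sp)
    also have "\<dots> = d * measure N (space m)"
      by (simp add: sp)
    also have "\<dots> \<le> d * C"
      using N(3) \<open>d > 0\<close> by (intro mult_left_mono) auto
    also have "\<dots> = \<epsilon>"
      using \<open>C > 0\<close> by (simp add: d_def)
    finally show "\<bar>integral\<^sup>L N h - integral\<^sup>L N g\<bar> \<le> \<epsilon>" .
  qed
  have "(\<lambda>n. integral\<^sup>L (M n) g) \<longlonglongrightarrow> integral\<^sup>L m g"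
    unfolding g_int[OF finite_M sets_M C(1)] g_int[OF finite_measure_axioms refl C(2)]
    by (intro tendsto_sum tendsto_mult tendsto_const setwise L)
  with approx[OF finite_M sets_M C(1)] approx[OF finite_measure_axioms refl C(2)]
  show "\<exists>b b'. b \<longlonglongrightarrow> b' \<and> (\<forall>n. \<bar>integral\<^sup>L (M n) h - b n\<bar> \<le> \<epsilon>) \<and> \<bar>integral\<^sup>L m h - b'\<bar> \<le> \<epsilon>"
    by blast
qed

text \<open>Fatou's lemma for varying measures: the truncations \<open>min h k\<close> are bounded, so the bound
  on their integrals passes from \<open>M n\<close> to \<open>m\<close>; then \<open>k\<close> tends to infinity under the fixed measure
  \<open>m\<close> by the classical Fatou lemma.\<close>

lemma integral_limit_le:
  fixes h :: "'a \<Rightarrow> real"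
  assumes h [measurable]: "h \<in> borel_measurable m" and nonneg: "\<And>x. h x \<ge> 0"
    and int: "\<And>n. integrable (M n) h" and le: "\<And>n. integral\<^sup>L (M n) h \<le> C"
  shows "integrable m h" "integral\<^sup>L m h \<le> C"
proof -
  have "C \<ge> 0"
    using le[of 0] nonneg by (meson Bochner_Integration.integral_nonneg order_trans)
  have trunc: "(\<integral>x. min (h x) (real k) \<partial>m) \<le> C" for k
  proof (rule LIMSEQ_le_const2)
    show "(\<lambda>n. \<integral>x. min (h x) (real k) \<partial>M n) \<longlonglongrightarrow> (\<integral>x. min (h x) (real k) \<partial>m)"
      using nonneg by (intro tendsto_integral_bounded[where B = "real k"]) (auto simp: min_def)
    have "(\<integral>x. min (h x) (real k) \<partial>M n) \<le> C" for n
    proof -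
      have "(\<integral>x. min (h x) (real k) \<partial>M n) \<le> integral\<^sup>L (M n) h"
        using nonneg
        by (intro integral_mono[OF _ int] integrable_bounded[where B = "real k"])
          (auto simp: min_def)
      with le[of n] show ?thesis by simp
    qed
    then show "\<exists>N. \<forall>n\<ge>N. (\<integral>x. min (h x) (real k) \<partial>M n) \<le> C" by blast
  qed
  have "(\<integral>\<^sup>+x. ennreal (h x) \<partial>m) \<le> (\<integral>\<^sup>+x. liminf (\<lambda>k. ennreal (min (h x) (real k))) \<partial>m)"
  proof (rule nn_integral_mono)
    fix x
    obtain K where K: "h x \<le> real K" 
      using real_arch_simple by blast
    then have "(\<lambda>k. ennreal (min (h x) (real k))) \<longlonglongrightarrow> ennreal (h x)"
      by (intro tendsto_eventually eventually_sequentiallyI[of K]) (auto simp: min_def)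
    then show "ennreal (h x) \<le> liminf (\<lambda>k. ennreal (min (h x) (real k)))"
      by (simp add: lim_imp_Liminf)
  qed
  also have "\<dots> \<le> liminf (\<lambda>k. \<integral>\<^sup>+x. ennreal (min (h x) (real k)) \<partial>m)"
    by (intro nn_integral_liminf) measurable
  also have "\<dots> \<le> ennreal C"
  proof -
    have "(\<integral>\<^sup>+x. ennreal (min (h x) (real k)) \<partial>m) \<le> ennreal C" for k
      using nonneg trunc[of k]
      by (subst nn_integral_eq_integral)
        (auto intro!: integrable_bounded[where B = "real k"] ennreal_leI simp: min_def)
    then show ?thesis
      by (intro Liminf_le) auto
  qed
  finally have nn: "(\<integral>\<^sup>+x. ennreal (h x) \<partial>m) \<le> ennreal C" .
  then show "integrable m h"
    using nonneg by (intro integrableI_bounded) (auto simp: order_le_less_trans)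
  then show "integral\<^sup>L m h \<le> C"
    using nn nonneg \<open>C \<ge> 0\<close> by (simp add: nn_integral_eq_integral)
qed

text \<open>The integrals are taken with respect to \<open>M n\<close>, but smallness of a set is measured by the
  one measure \<open>m\<close>: a set that shrinks with respect to \<open>m\<close> is then negligible for all \<open>n\<close> at
  once. Integrability is demanded explicitly because the Bochner integral of a non-integrable
  function is 0, which would satisfy the estimate vacuously.\<close>

definition equi_integrable :: "(nat \<Rightarrow> 'a \<Rightarrow> real) \<Rightarrow> bool" where
  "equi_integrable F \<longleftrightarrow> (\<forall>n. F n \<in> borel_measurable m \<and> integrable (M n) (F n)) \<and>
     (\<forall>\<epsilon>>0. \<exists>\<delta>>0. \<forall>n. \<forall>A\<in>sets m. measure m A < \<delta> \<longrightarrow>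
        (\<integral>x. indicator A x * \<bar>F n x\<bar> \<partial>M n) < \<epsilon>)"

lemma equi_integrableD:
  assumes "equi_integrable F"
  shows "F n \<in> borel_measurable m" "integrable (M n) (F n)"
    and "\<epsilon> > 0 \<Longrightarrow> \<exists>\<delta>>0. \<forall>n. \<forall>A\<in>sets m. measure m A < \<delta> \<longrightarrow>
        (\<integral>x. indicator A x * \<bar>F n x\<bar> \<partial>M n) < \<epsilon>"
  using assms unfolding equi_integrable_def by auto

text \<open>The sets where \<open>\<bar>f\<bar> > k\<close> decrease to the empty set, so their \<open>m\<close>-measure falls below any
  \<open>\<delta>\<close>; a single \<open>k\<close> then serves all \<open>M n\<close>.\<close>

lemma equi_integrable_tail:
  assumes f: "equi_integrable (\<lambda>_. f)" and "\<epsilon> > 0"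
  obtains k :: nat where "\<And>n. (\<integral>x. indicator {x \<in> space m. real k < \<bar>f x\<bar>} x * \<bar>f x\<bar> \<partial>M n) < \<epsilon>"
proof -
  have [measurable]: "f \<in> borel_measurable m"
    using equi_integrableD(1)[OF f] .
  obtain \<delta> where "\<delta> > 0" and \<delta>: "\<And>n A. A \<in> sets m \<Longrightarrow> measure m A < \<delta> \<Longrightarrow>
      (\<integral>x. indicator A x * \<bar>f x\<bar> \<partial>M n) < \<epsilon>"
    using equi_integrableD(3)[OF f \<open>\<epsilon> > 0\<close>] by blast
  let ?B = "\<lambda>k::nat. {x \<in> space m. real k < \<bar>f x\<bar>}"
  have "x \<notin> (\<Inter>k. ?B k)" for x
    using real_arch_simple[of "\<bar>f x\<bar>"] by (auto dest: leD)
  then have "(\<Inter>k. ?B k) = {}"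
    by blast
  moreover have "(\<lambda>k. measure m (?B k)) \<longlonglongrightarrow> measure m (\<Inter>k. ?B k)"
    by (rule finite_Lim_measure_decseq) (auto simp: decseq_def)
  ultimately have "\<forall>\<^sub>F k in sequentially. measure m (?B k) < \<delta>"
    using \<open>\<delta> > 0\<close> by (intro order_tendstoD) auto
  then obtain k where "measure m (?B k) < \<delta>"
    by (auto simp: eventually_sequentially)
  then show thesis
    by (intro that[of k] \<delta>) auto
qed

lemma equi_integrable_tail_limit:
  assumes f: "equi_integrable (\<lambda>_. f)" and "\<epsilon> > 0"
  obtains k :: nat where
    "\<And>n. (\<integral>x. indicator {x \<in> space m. real k < \<bar>f x\<bar>} x * \<bar>f x\<bar> \<partial>M n) \<le> \<epsilon>"
    "integrable m (\<lambda>x. indicator {x \<in> space m. real k < \<bar>f x\<bar>} x * \<bar>f x\<bar>)"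
    "(\<integral>x. indicator {x \<in> space m. real k < \<bar>f x\<bar>} x * \<bar>f x\<bar> \<partial>m) \<le> \<epsilon>"
proof -
  obtain k :: nat where
    k: "\<And>n. (\<integral>x. indicator {x \<in> space m. real k < \<bar>f x\<bar>} x * \<bar>f x\<bar> \<partial>M n) < \<epsilon>"
    using equi_integrable_tail[OF assms] by blast
  note [measurable] = equi_integrableD(1)[OF f]
  have int: "integrable (M n) (\<lambda>x. indicator {x \<in> space m. real k < \<bar>f x\<bar>} x * \<bar>f x\<bar>)" for n
    using equi_integrableD(2)[OF f] sets_M by (intro integrable_indicator_mult) auto
  show thesis
    using k int
    by (intro that[of k] integral_limit_le) (auto intro: less_imp_le)
qed

text \<open>Below a level \<open>k\<close> the function is bounded, and above it the tail is integrable by the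
  preceding lemma.\<close>

lemma equi_integrable_imp_integrable_limit:
  assumes f: "equi_integrable (\<lambda>_. f)"
  shows "integrable m f"
proof -
  note [measurable] = equi_integrableD(1)[OF f]
  obtain k :: nat where
    k: "integrable m (\<lambda>x. indicator {x \<in> space m. real k < \<bar>f x\<bar>} x * \<bar>f x\<bar>)"
    using equi_integrable_tail_limit[OF f zero_less_one] by blast
  have "integrable m (\<lambda>x. indicator {x \<in> space m. real k < \<bar>f x\<bar>} x * \<bar>f x\<bar> + real k)"
    using k by auto
  then show ?thesis
    by (rule Bochner_Integration.integrable_bound) (auto split: split_indicator)
qed

text \<open>Discarding from \<open>A\<close> the set where \<open>\<bar>f\<bar> > k\<close> leaves a bounded integrand, at a cost controlled by
  the tail, uniformly over all \<open>M n\<close> and \<open>m\<close>.\<close>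

lemma tendsto_set_integral:
  assumes f: "equi_integrable (\<lambda>_. f)" and A [measurable]: "A \<in> sets m"
  shows "(\<lambda>n. \<integral>x. indicator A x * f x \<partial>M n) \<longlonglongrightarrow> (\<integral>x. indicator A x * f x \<partial>m)"
proof (rule tendsto_by_approximation)
  fix \<epsilon> :: real assume "\<epsilon> > 0"
  note [measurable] = equi_integrableD(1)[OF f]
  obtain k :: nat where k:
    "\<And>n. (\<integral>x. indicator {x \<in> space m. real k < \<bar>f x\<bar>} x * \<bar>f x\<bar> \<partial>M n) \<le> \<epsilon>"
    "(\<integral>x. indicator {x \<in> space m. real k < \<bar>f x\<bar>} x * \<bar>f x\<bar> \<partial>m) \<le> \<epsilon>"
    using equi_integrable_tail_limit[OF f \<open>\<epsilon> > 0\<close>] by blast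
  define B where "B = {x \<in> space m. real k < \<bar>f x\<bar>}"
  have B [measurable]: "B \<in> sets m"
    unfolding B_def by measurable
  define h where "h x = indicator (A - B) x * f x" for x
  have h [measurable]: "h \<in> borel_measurable m"
    unfolding h_def by measurable
  have h_bound: "\<bar>h x\<bar> \<le> real k" for x
    using sets.sets_into_space[OF A] by (auto simp: h_def B_def split: split_indicator)
  have approx: "\<bar>(\<integral>x. indicator A x * f x \<partial>N) - integral\<^sup>L N h\<bar> \<le> \<epsilon>"
    if N: "sets N = sets m" "integrable N f" "integrable N h"
      and tail: "(\<integral>x. indicator B x * \<bar>f x\<bar> \<partial>N) \<le> \<epsilon>" for N
  proof -
    have int: "integrable N (\<lambda>x. indicator A x * f x)" "integrable N (\<lambda>x. indicator B x * \<bar>f x\<bar>)"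
      using N A B by (simp_all add: integrable_indicator_mult)
    have "\<bar>(\<integral>x. indicator A x * f x \<partial>N) - integral\<^sup>L N h\<bar> = \<bar>\<integral>x. indicator A x * f x - h x \<partial>N\<bar>"
      using int N by simp
    also have "\<dots> \<le> (\<integral>x. \<bar>indicator A x * f x - h x\<bar> \<partial>N)"
      by (rule integral_abs_bound)
    also have "\<dots> \<le> (\<integral>x. indicator B x * \<bar>f x\<bar> \<partial>N)"
    proof (intro integral_mono)
      show "\<bar>indicator A x * f x - h x\<bar> \<le> indicator B x * \<bar>f x\<bar>" for x
        by (auto simp: h_def split: split_indicator)
    qed (use int N in auto)
    finally show ?thesis
      using tail by simp
  qed
  have "(\<lambda>n. integral\<^sup>L (M n) h) \<longlonglongrightarrow> integral\<^sup>L m h"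
    using h h_bound by (rule tendsto_integral_bounded)
  moreover have "\<bar>(\<integral>x. indicator A x * f x \<partial>M n) - integral\<^sup>L (M n) h\<bar> \<le> \<epsilon>" for n
    using k(1) by (intro approx sets_M equi_integrableD(2)[OF f] integrable_bounded[OF h h_bound])
      (auto simp: B_def)
  moreover have "\<bar>(\<integral>x. indicator A x * f x \<partial>m) - integral\<^sup>L m h\<bar> \<le> \<epsilon>"
    using k(2) by (intro approx refl equi_integrable_imp_integrable_limit[OF f]
        integrable_bounded[OF h h_bound]) (auto simp: B_def)
  ultimately show "\<exists>b b'. b \<longlonglongrightarrow> b' \<and> (\<forall>n. \<bar>(\<integral>x. indicator A x * f x \<partial>M n) - b n\<bar> \<le> \<epsilon>) \<and>
      \<bar>(\<integral>x. indicator A x * f x \<partial>m) - b'\<bar> \<le> \<epsilon>"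
    by blast
qed

text \<open>The convergence of \<open>F n\<close> is known only \<open>m\<close>-almost everywhere. It yields exceptional sets \<open>E n\<close>
  of vanishing \<open>m\<close>-measure, on which equi-integrability bounds \<open>\<bar>F n\<bar>\<close> and \<open>\<bar>f\<bar>\<close> separately.\<close>

lemma tendsto_integral_abs_diff:
  assumes F: "equi_integrable F" and f: "equi_integrable (\<lambda>_. f)"
    and lim: "AE x in m. (\<lambda>n. F n x) \<longlonglongrightarrow> f x"
  shows "(\<lambda>n. \<integral>x. \<bar>F n x - f x\<bar> \<partial>M n) \<longlonglongrightarrow> 0"
proof (rule LIMSEQ_I)
  fix r :: real assume "r > 0"
  note meas [measurable] = equi_integrableD(1)[OF F] equi_integrableD(1)[OF f]
  obtain C where "C > 0" and C: "\<And>n. measure (M n) (space m) \<le> C"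
    by (rule mass_bounded) blast
  define \<eta> where "\<eta> = r / (3 * C)"
  have "\<eta> > 0"
    using \<open>C > 0\<close> \<open>r > 0\<close> by (simp add: \<eta>_def)
  define E where "E n = {x \<in> space m. \<eta> < \<bar>F n x - f x\<bar>}" for n
  have E [measurable]: "E n \<in> sets m" for n
    unfolding E_def by measurable
  have "r / 3 > 0"
    using \<open>r > 0\<close> by simp
  obtain d1 where "d1 > 0" and d1: "\<And>n A. A \<in> sets m \<Longrightarrow> measure m A < d1 \<Longrightarrow>
      (\<integral>x. indicator A x * \<bar>F n x\<bar> \<partial>M n) < r / 3"
    using equi_integrableD(3)[OF F \<open>r / 3 > 0\<close>] by blast
  obtain d2 where "d2 > 0" and d2: "\<And>n A. A \<in> sets m \<Longrightarrow> measure m A < d2 \<Longrightarrow>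
      (\<integral>x. indicator A x * \<bar>f x\<bar> \<partial>M n) < r / 3"
    using equi_integrableD(3)[OF f \<open>r / 3 > 0\<close>] by blast
  have "(\<lambda>n. measure m (E n)) \<longlonglongrightarrow> 0"
    unfolding E_def using meas lim \<open>\<eta> > 0\<close> by (rule tendsto_measure_deviation)
  then have "\<forall>\<^sub>F n in sequentially. measure m (E n) < min d1 d2"
    using \<open>d1 > 0\<close> \<open>d2 > 0\<close> by (intro order_tendstoD) auto
  then obtain N where N: "\<And>n. n \<ge> N \<Longrightarrow> measure m (E n) < min d1 d2"
    by (auto simp: eventually_sequentially)
  have "norm ((\<integral>x. \<bar>F n x - f x\<bar> \<partial>M n) - 0) < r" if "n \<ge> N" for n
  proof -
    interpret Mn: finite_measure "M n"
      by (rule finite_M)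
    have int: "integrable (M n) (F n)" "integrable (M n) f"
      using equi_integrableD(2)[OF F] equi_integrableD(2)[OF f] .
    have intE: "integrable (M n) (\<lambda>x. indicator (E n) x * \<bar>F n x\<bar>)"
        "integrable (M n) (\<lambda>x. indicator (E n) x * \<bar>f x\<bar>)"
      using int E sets_M by (auto intro!: integrable_indicator_mult)
    have "(\<integral>x. \<bar>F n x - f x\<bar> \<partial>M n)
        \<le> (\<integral>x. indicator (E n) x * \<bar>F n x\<bar> + indicator (E n) x * \<bar>f x\<bar> + \<eta> \<partial>M n)"
      using int intE \<open>\<eta> > 0\<close>
      by (intro integral_mono) (auto simp: E_def space_M split: split_indicator)
    also have "\<dots> = (\<integral>x. indicator (E n) x * \<bar>F n x\<bar> \<partial>M n) +
        (\<integral>x. indicator (E n) x * \<bar>f x\<bar> \<partial>M n) + \<eta> * measure (M n) (space m)"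
      using intE by (simp add: space_M)
    also have "\<dots> < r / 3 + r / 3 + \<eta> * C"
      using d1[OF E, of n n] d2[OF E, of n n] N[OF that] C[of n] \<open>\<eta> > 0\<close>
      by (intro add_less_le_mono add_strict_mono mult_left_mono) auto
    also have "\<dots> = r"
      using \<open>C > 0\<close> by (simp add: \<eta>_def)
    finally show ?thesis
      by simp
  qed
  then show "\<exists>N. \<forall>n\<ge>N. norm ((\<integral>x. \<bar>F n x - f x\<bar> \<partial>M n) - 0) < r"
    by blast
qed

theorem tendsto_set_integral_varying:
  assumes F: "equi_integrable F" and f: "equi_integrable (\<lambda>_. f)"
    and lim: "AE x in m. (\<lambda>n. F n x) \<longlonglongrightarrow> f x" and A: "A \<in> sets m"
  shows "(\<lambda>n. \<integral>x. indicator A x * F n x \<partial>M n) \<longlonglongrightarrow> (\<integral>x. indicator A x * f x \<partial>m)"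
proof -
  have "\<bar>(\<integral>x. indicator A x * F n x \<partial>M n) - (\<integral>x. indicator A x * f x \<partial>M n)\<bar>
      \<le> (\<integral>x. \<bar>F n x - f x\<bar> \<partial>M n)" for n
  proof -
    have int: "integrable (M n) (F n)" "integrable (M n) f"
      using equi_integrableD(2)[OF F] equi_integrableD(2)[OF f] .
    have intA: "integrable (M n) (\<lambda>x. indicator A x * F n x)"
        "integrable (M n) (\<lambda>x. indicator A x * f x)"
      using int A sets_M by (auto intro!: integrable_indicator_mult)
    have "\<bar>(\<integral>x. indicator A x * F n x \<partial>M n) - (\<integral>x. indicator A x * f x \<partial>M n)\<bar>
        = \<bar>\<integral>x. indicator A x * F n x - indicator A x * f x \<partial>M n\<bar>"
      using intA by simp
    also have "\<dots> \<le> (\<integral>x. \<bar>indicator A x * F n x - indicator A x * f x\<bar> \<partial>M n)"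
      by (rule integral_abs_bound)
    also have "\<dots> \<le> (\<integral>x. \<bar>F n x - f x\<bar> \<partial>M n)"
      using int intA by (intro integral_mono) (auto split: split_indicator)
    finally show ?thesis .
  qed
  then have "(\<lambda>n. (\<integral>x. indicator A x * F n x \<partial>M n) - (\<integral>x. indicator A x * f x \<partial>M n)) \<longlonglongrightarrow> 0"
    by (intro Lim_null_comparison[OF _ tendsto_integral_abs_diff[OF F f lim]]) auto
  from tendsto_add[OF this tendsto_set_integral[OF f A]] show ?thesis
    by simp
qed

end

section \<open>From vague to setwise convergence\<close>

lemma finite_measures_borelD:
  assumes "N \<in> finite_measures_borel"
  shows "finite_measure N" "sets N = sets borel" "space N = UNIV"
  using assms sets_eq_imp_space_eq[of N borel] by (auto simp: finite_measures_borel_def)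

lemma radon_inner_approx:
  assumes m: "m \<in> finite_measures_borel" and "radon m" and A: "A \<in> sets borel" and "\<delta> > 0"
  obtains K where "compact K" "K \<subseteq> A" "measure m A < measure m K + \<delta>"
proof (cases "measure m A = 0")
  case True
  with \<open>\<delta> > 0\<close> show thesis
    by (intro that[of "{}"]) auto
next
  case False
  interpret finite_measure m
    using m by (rule finite_measures_borelD)
  have "ennreal (measure m A - \<delta>) < emeasure m A"
    using False \<open>\<delta> > 0\<close> zero_less_measure_iff[of m A]
    by (auto simp: emeasure_eq_measure ennreal_less_iff ennreal_lessI)
  also have "\<dots> = (SUP K\<in>{K. K \<subseteq> A \<and> compact K}. emeasure m K)"
    using \<open>radon m\<close> A finite_measures_borelD(2)[OF m] by (simp add: radon_def)
  finally obtain K where K: "K \<subseteq> A" "compact K" "ennreal (measure m A - \<delta>) < emeasure m K"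
    by (auto simp: less_SUP_iff)
  then have "measure m A - \<delta> < measure m K"
    by (metis emeasure_eq_measure ennreal_leI not_less)
  with K show thesis
    by (intro that[of K]) auto
qed

text \<open>Inner regularity applied to the complement of \<open>A\<close> is outer regularity at \<open>A\<close>: the complement of a
  compact subset of \<open>- A\<close> is open, since compact sets are closed in a Hausdorff space.\<close>

lemma radon_sandwich:
  fixes m :: "'a::t2_space measure"
  assumes m: "m \<in> finite_measures_borel" and "radon m" and A: "A \<in> sets borel" and "\<delta> > 0"
  obtains K U where "compact K" "open U" "K \<subseteq> A" "A \<subseteq> U" "measure m (U - K) < \<delta>"
proof -
  interpret finite_measure m
    using m by (rule finite_measures_borelD)
  note sets_m = finite_measures_borelD(2)[OF m]
  obtain K where K: "compact K" "K \<subseteq> A" "measure m A < measure m K + \<delta> / 2"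
    using radon_inner_approx[OF assms(1-3), of "\<delta> / 2"] \<open>\<delta> > 0\<close> by auto
  obtain L where L: "compact L" "L \<subseteq> - A" "measure m (- A) < measure m L + \<delta> / 2"
    using radon_inner_approx[OF assms(1,2), of "- A" "\<delta> / 2"] A \<open>\<delta> > 0\<close> by auto
  have [simp]: "A \<in> sets m" "K \<in> sets m" "L \<in> sets m"
    using A K L by (auto simp: sets_m borel_compact)
  have "- L - K = (A - K) \<union> (- A - L)"
    using K L by auto
  then have "measure m (- L - K) \<le> measure m (A - K) + measure m (- A - L)"
    by (metis A K(1) L(1) borel_comp borel_compact measure_Un_le sets.Diff sets_m)
  also have "\<dots> < \<delta>"
    using K L finite_measure_Diff[of A K] finite_measure_Diff[of "- A" L] A sets_m
    by (auto simp: borel_compact)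
  finally show thesis
    using K L by (intro that[of K "- L"]) (auto simp: compact_imp_closed)
qed

text \<open>A locally compact Hausdorff space is completely regular, which separates \<open>K\<close> from the
  complement of \<open>U\<close>. To make the separating function vanish at infinity, \<open>U\<close> is first shrunk to
  its intersection with a neighbourhood \<open>V\<close> of \<open>K\<close> that is contained in a compact set.\<close>

lemma Urysohn_C0:
  fixes K U :: "'a::t2_space set"
  assumes lc: "locally_compact_space (euclidean :: 'a topology)"
    and "compact K" "open U" "K \<subseteq> U"
  obtains g where "g \<in> C0" "\<And>x. 0 \<le> g x" "\<And>x. g x \<le> 1" "\<And>x. x \<in> K \<Longrightarrow> g x = (1::real)"
    "\<And>x. x \<notin> U \<Longrightarrow> g x = 0"
proof -
  have haus: "Hausdorff_space (euclidean :: 'a topology)"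
    unfolding Hausdorff_space_def disjnt_def
    by (metis hausdorff open_openin)
  obtain V L where V: "open V" "compact L" "K \<subseteq> V" "V \<subseteq> L"
    using lc haus \<open>compact K\<close>
    by (metis locally_compact_space_compact_closed_compact compactin_euclidean_iff open_openin)
  have creg: "completely_regular_space (euclidean :: 'a topology)"
    using lc haus locally_compact_Hausdorff_imp_regular_space
    by (simp add: completely_regular_eq_regular_space)
  have "closedin euclidean (- (U \<inter> V))"
    using \<open>open U\<close> \<open>open V\<close> by (simp add: closed_Un closed_Compl)
  moreover have "disjnt (- (U \<inter> V)) K"
    using \<open>K \<subseteq> U\<close> \<open>K \<subseteq> V\<close> by (auto simp: disjnt_def)
  ultimately obtain g :: "'a \<Rightarrow> real" where g: "continuous_map euclidean (top_of_set {0..1}) g"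
      "g ` (- (U \<inter> V)) \<subseteq> {0}" "g ` K \<subseteq> {1}"
    using creg \<open>compact K\<close>
    by (auto simp: disjnt_sym
        intro: Urysohn_completely_regular_compact_closed[of 0 1 euclidean K "- (U \<inter> V)"])
  have cont: "continuous_on UNIV g" and range: "g x \<in> {0..1}" for x
    using g(1) by (auto simp: continuous_map_in_subtopology)
  have zero: "g x = 0" if "x \<notin> U \<inter> V" for x
    using g(2) that by blast
  have "g x = 0" if "x \<notin> L" for x
    using that \<open>V \<subseteq> L\<close> by (intro zero) auto
  then have "g \<in> C0"
    unfolding C0_def using cont \<open>compact L\<close> by (auto intro!: exI[of _ L])
  then show thesis
    using range zero g(3) by (intro that[of g]) auto
qed

text \<open>The pair \<open>K \<subseteq> A \<subseteq> U\<close> comes from the regularity of \<open>m\<close>, and uniform absolute continuity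
  transfers the smallness of \<open>U - K\<close> to every \<open>M n\<close>.\<close>

lemma vague_imp_setwise:
  fixes m :: "'a::t2_space measure"
  assumes lc: "locally_compact_space (euclidean :: 'a topology)"
    and m: "m \<in> finite_measures_borel" and M: "\<And>n. M n \<in> finite_measures_borel"
    and "radon m" and vague: "vaguely_convergent M m"
    and uac: "uniformly_absolutely_continuous M m" and A: "A \<in> sets borel"
  shows "(\<lambda>n. measure (M n) A) \<longlonglongrightarrow> measure m A"
proof (rule tendsto_by_approximation)
  fix \<epsilon> :: real assume "\<epsilon> > 0"
  interpret finite_measure m
    using m by (rule finite_measures_borelD)
  obtain \<delta> :: real where "\<delta> > 0"
    and \<delta>: "\<And>E. E \<in> sets borel \<Longrightarrow> emeasure m E < ennreal \<delta> \<Longrightarrow> (SUP n. emeasure (M n) E) < ennreal \<epsilon>"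
    using uac \<open>\<epsilon> > 0\<close> unfolding uniformly_absolutely_continuous_def by meson
  obtain K U where KU: "compact K" "open U" "K \<subseteq> A" "A \<subseteq> U" "measure m (U - K) < min \<delta> \<epsilon>"
    using radon_sandwich[OF m \<open>radon m\<close> A, of "min \<delta> \<epsilon>"] \<open>\<delta> > 0\<close> \<open>\<epsilon> > 0\<close> by auto
  have [measurable]: "K \<in> sets borel" "U \<in> sets borel"
    using KU by (auto simp: borel_compact)
  obtain g :: "'a \<Rightarrow> real" where g: "g \<in> C0" "\<And>x. 0 \<le> g x" "\<And>x. g x \<le> 1" 
      "\<And>x. x \<in> K \<Longrightarrow> g x = 1" "\<And>x. x \<notin> U \<Longrightarrow> g x = 0"
    using Urysohn_C0[OF lc, of K U] KU by blast
  have g_meas: "g \<in> borel_measurable borel"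
    using g(1) by (auto simp: C0_def intro: borel_measurable_continuous_onI)
  have approx: "\<bar>measure N A - integral\<^sup>L N g\<bar> \<le> \<epsilon>"
    if N: "N \<in> finite_measures_borel" and small: "measure N (U - K) \<le> \<epsilon>" for N
  proof -
    interpret N: finite_measure N
      using N by (rule finite_measures_borelD)
    note [measurable_cong] = finite_measures_borelD(2)[OF N]
    note [measurable] = g_meas A
    have int_g: "integrable N g"
      using g by (intro N.integrable_const_bound[where B = 1]) auto
    have int_A: "integrable N (indicator A :: 'a \<Rightarrow> real)" "integrable N (indicator (U - K) :: 'a \<Rightarrow> real)"
      by (auto simp: N.emeasure_finite less_top[symmetric])
    have "\<bar>measure N A - integral\<^sup>L N g\<bar> = \<bar>\<integral>x. indicator A x - g x \<partial>N\<bar>"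
      using int_g int_A by (simp add: finite_measures_borelD(3)[OF N])
    also have "\<dots> \<le> (\<integral>x. \<bar>indicator A x - g x\<bar> \<partial>N)"
      by (rule integral_abs_bound)
    also have "\<dots> \<le> (\<integral>x. indicator (U - K) x \<partial>N)"
    proof (intro integral_mono)
      show "\<bar>indicator A x - g x\<bar> \<le> indicator (U - K) x" for x
        using g(2-5)[of x] KU by (auto split: split_indicator)
    qed (use int_g int_A in auto)
    also have "\<dots> = measure N (U - K)"
      by (simp add: finite_measures_borelD(3)[OF N])
    finally show ?thesis
      using small by simp
  qed
  have "measure (M n) (U - K) \<le> \<epsilon>" for n
  proof -
    have "emeasure m (U - K) < ennreal \<delta>"
      using KU(5) by (simp add: emeasure_eq_measure ennreal_less_iff)
    then have "(SUP n. emeasure (M n) (U - K)) < ennreal \<epsilon>"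
      by (intro \<delta>) auto
    then have "emeasure (M n) (U - K) < ennreal \<epsilon>"
      by (meson SUP_upper UNIV_I order_le_less_trans)
    then show ?thesis
      using \<open>\<epsilon> > 0\<close> by (simp add: measure_def enn2real_leI)
  qed
  with approx[OF M] approx[OF m] KU(5) vague g(1)
  show "\<exists>b b'. b \<longlonglongrightarrow> b' \<and> (\<forall>n. \<bar>measure (M n) A - b n\<bar> \<le> \<epsilon>) \<and> \<bar>measure m A - b'\<bar> \<le> \<epsilon>"
    unfolding vaguely_convergent_def
    by (intro exI[of _ "\<lambda>n. integral\<^sup>L (M n) g"] exI[of _ "integral\<^sup>L m g"]) auto
qed

section \<open>Convergence of integrals under vague convergence\<close>

theorem theorem3p4:
  fixes m :: "'a::t2_space measure"
    and M :: "nat \<Rightarrow> 'a measure"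
    and f :: "'a \<Rightarrow> real"
    and F :: "nat \<Rightarrow> 'a \<Rightarrow> real"
  assumes "locally_compact_space (euclidean :: 'a topology)"
    and "m \<in> finite_measures_borel"
    and "\<And>n. M n \<in> finite_measures_borel"
    and "radon m"
    and "f \<in> borel_measurable borel"
    and "\<And>n. F n \<in> borel_measurable borel"
    and "AE t in m. (\<lambda>n. F n t) \<longlonglongrightarrow> f t"
    and "continuous_on UNIV f"
    and "uac_integrals M F"
    and "uac_integrals M (\<lambda>n. f)"
    and "vaguely_convergent M m"
    and "uniformly_absolutely_continuous M m"
  shows "integrable m f \<and>
         (\<forall>A\<in>sets borel. (\<lambda>n. LINT t:A|M n. F n t) \<longlonglongrightarrow> (LINT t:A|m. f t))"
proof -
  note sets_m = finite_measures_borelD(2)[OF assms(2)]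
  note sets_M = finite_measures_borelD(2)[OF assms(3)]
  interpret setwise_limit m M
  proof (intro setwise_limit.intro setwise_limit_axioms.intro)
    show "(\<lambda>n. measure (M n) A) \<longlonglongrightarrow> measure m A" if "A \<in> sets m" for A
      using vague_imp_setwise[OF assms(1-4,11,12)] that sets_m by simp
  qed (use finite_measures_borelD[OF assms(2)] finite_measures_borelD[OF assms(3)] in auto)
  \<comment> \<open>Two moduli compose: small \<open>m\<close>-measure forces small \<open>M n\<close>-measure for all \<open>n\<close>, and that forces
    small integrals.\<close>
  have equi: "equi_integrable G"
    if G: "\<And>n. G n \<in> borel_measurable borel" and uac_G: "uac_integrals M G" for G
    unfolding equi_integrable_def
  proof (intro conjI allI impI)
    show int: "integrable (M n) (G n)" for n
      using uac_integrals_integrable[OF assms(3) G uac_G] .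
    show "G n \<in> borel_measurable m" for n
      using G sets_m measurable_cong_sets by blast
    fix \<epsilon> :: real assume "\<epsilon> > 0"
    then obtain d :: real where "d > 0" and d: "\<And>n A. A \<in> sets borel \<Longrightarrow> emeasure (M n) A < ennreal d \<Longrightarrow>
        (\<integral>\<^sup>+t\<in>A. ennreal \<bar>G n t\<bar> \<partial>M n) < ennreal \<epsilon>"
      using uac_G unfolding uac_integrals_def by meson
    obtain \<delta> :: real where "\<delta> > 0" and \<delta>: "\<And>E. E \<in> sets borel \<Longrightarrow> emeasure m E < ennreal \<delta> \<Longrightarrow>
        (SUP n. emeasure (M n) E) < ennreal d"
      using assms(12) \<open>d > 0\<close> unfolding uniformly_absolutely_continuous_def by meson
    have "(\<integral>x. indicator A x * \<bar>G n x\<bar> \<partial>M n) < \<epsilon>" if A: "A \<in> sets m" "measure m A < \<delta>" for n A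
    proof -
      have "emeasure m A < ennreal \<delta>"
        using A by (simp add: emeasure_eq_measure ennreal_less_iff)
      then have "emeasure (M n) A < ennreal d"
        using \<delta>[of A] A(1) sets_m by (metis SUP_upper UNIV_I order_le_less_trans)
      then have "(\<integral>\<^sup>+t\<in>A. ennreal \<bar>G n t\<bar> \<partial>M n) < ennreal \<epsilon>"
        using d A(1) sets_m by blast
      also have "(\<integral>\<^sup>+t\<in>A. ennreal \<bar>G n t\<bar> \<partial>M n) = (\<integral>\<^sup>+t. ennreal (indicator A t * \<bar>G n t\<bar>) \<partial>M n)"
        by (intro nn_integral_cong) (auto split: split_indicator)
      also have "\<dots> = ennreal (\<integral>t. indicator A t * \<bar>G n t\<bar> \<partial>M n)"
        using A(1) int sets_m sets_M
        by (intro nn_integral_eq_integral integrable_indicator_mult) auto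
      finally show ?thesis
        by (simp add: ennreal_less_iff)
    qed
    with \<open>\<delta> > 0\<close> show "\<exists>\<delta>>0. \<forall>n. \<forall>A\<in>sets m. measure m A < \<delta> \<longrightarrow>
        (\<integral>x. indicator A x * \<bar>G n x\<bar> \<partial>M n) < \<epsilon>"
      by blast
  qed
  have "equi_integrable F" "equi_integrable (\<lambda>_. f)"
    using equi assms(5,6,9,10) by auto
  then show ?thesis
    using equi_integrable_imp_integrable_limit tendsto_set_integral_varying assms(7) sets_m
    unfolding set_lebesgue_integral_def by simp
qed

end
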